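(* Let $G\in\{\mathbb{Z}_n, D_{2n}, Q_{2^n}, Dic_n\}$, where $n=p_1^{a_1}p_2^{a_2}\cdots p_k^{a_k}$ and $a_i\ge 1$. Also let $H$ be a cyclic subgroup of $G$ such that $|H|=p_1^{b_1}p_2^{b_2}\cdots p_k^{b_k}$, and let $m(H)=|\{i : b_i=0\}|$ and $r(H)=|\{i : b_i=a_i\}|$, for $1\le i\le k$. Then the degree of $H$ in $\Gamma(G)$ is as follows. (a) If $G=\mathbb{Z}_n$, then $\deg(H)=2k-m(H)-r(H)$. (b) If $G=D_{2n}$, then $\deg(H)=1$ if $H$ is generated by a reflection; $\deg(H)=k+n$ if $H=\{e\}$; and $\deg(H)=2k-m(H)-r(H)$ if $H\neq\{e\}$ and $H$ is generated by a rotation. (c) If $G=Q_{2^n}$, then $\deg(H)=2^{n-2}+1$ if $H\cong\mathbb{Z}_2$; $\deg(H)=2$ if $\{e\}\lneq H\lneq\mathbb{Z}_{2^{n-1}}$ and $H\not\cong\mathbb{Z}_2$; and $\deg(H)=1$ otherwise. (d) If $G=Dic_n$, then $\deg(H)=k+n+1$ if $H\cong\mathbb{Z}_2$; $\deg(H)=2k-m(H)-r(H)$ if $H\le\mathbb{Z}_{2n}$, where $n$ is even and $|H|\neq 2$; $\deg(H)=2(k+1)-m(H)-r(H)$ if $H\le\mathbb{Z}_{2n}$, where $n$ is odd and $|H|=2^{b_{k+1}}p_1^{b_1}p_2^{b_2}\cdots p_k^{b_k}\neq 2$; and $\deg(H)=1$ otherwise.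
   Context: For a finite group $G$, the cyclic subgroup graph $\Gamma(G)$ is the simple undirected graph whose vertex set is $C(G)$, the set of all cyclic subgroups of $G$ (including the trivial subgroup $\{e\}$), and in which two distinct vertices $H_1$ and $H_2$ are adjacent if $H_1\le H_2$ (or vice versa) and there is no subgroup $K$ with $H_1<K<H_2$ (respectively, $H_2<K<H_1$). $\deg(H)$ is the degree of the vertex $H$ in $\Gamma(G)$. $p_1,p_2,\ldots$ denote distinct primes. $\mathbb{Z}_n$ is the cyclic group of order $n$; $D_{2n}=\langle r,s : r^n=s^2=e,\ srs=r^{-1}\rangle$ is the dihedral group of order $2n$, whose rotations are the elements $r^i$ and whose reflections are the elements $sr^i$; $Q_{2^n}$ ($n\ge 3$) is the generalized quaternion group of order $2^n$, and within it $\mathbb{Z}_{2^{n-1}}$ denotes a cyclic subgroup of order $2^{n-1}$; $Dic_n=\langle x,y : x^{2n}=e,\ y^2=x^n,\ y^{-1}xy=x^{-1}\rangle$ is the dicyclic group of order $4n$, and within it $\mathbb{Z}_{2n}$ denotes the cyclic subgroup $\langle x\rangle$ of order $2n$.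
   Formalization: In (c) the degree for H ≅ Z_2 is corrected from 2^{n-2}+1 to 2^{n-2}+2 (in Q_8 it is 4, not 3); in (d) for n even, r(H) is taken with the prime exponents of 2n instead of those of n (for n=2, H=⟨x⟩ the printed formula gives 2, but the degree is 1). *)

theory Defs
  imports "HOL-Algebra.Elementary_Groups" "HOL-Computational_Algebra.Primes"
begin

definition cyclic_subgroups :: "('a, 'm) monoid_scheme \<Rightarrow> 'a set set" where
  "cyclic_subgroups G = {generate G {g} | g. g \<in> carrier G}"

definition covered_by :: "('a, 'm) monoid_scheme \<Rightarrow> 'a set \<Rightarrow> 'a set \<Rightarrow> bool" where
  "covered_by G H1 H2 \<longleftrightarrow> H1 \<subset> H2 \<and> \<not> (\<exists>K. subgroup K G \<and> H1 \<subset> K \<and> K \<subset> H2)"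

definition csg_adj :: "('a, 'm) monoid_scheme \<Rightarrow> 'a set \<Rightarrow> 'a set \<Rightarrow> bool" where
  "csg_adj G H1 H2 \<longleftrightarrow>
     H1 \<in> cyclic_subgroups G \<and> H2 \<in> cyclic_subgroups G \<and>
     (covered_by G H1 H2 \<or> covered_by G H2 H1)"

definition csg_degree :: "('a, 'm) monoid_scheme \<Rightarrow> 'a set \<Rightarrow> nat" where
  "csg_degree G H = card {K. csg_adj G H K}"

(* The three predicates below say that G, with the named generators, is the group with the
   given presentation. Generators satisfying the relations make G a quotient of the presented
   group; the order condition makes that quotient map an isomorphism. *)

definition dihedral :: "('a, 'm) monoid_scheme \<Rightarrow> nat \<Rightarrow> 'a \<Rightarrow> 'a \<Rightarrow> bool" where
  "dihedral G n r s \<longleftrightarrow>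
     group G \<and> r \<in> carrier G \<and> s \<in> carrier G \<and> generate G {r, s} = carrier G \<and>
     order G = 2 * n \<and>
     r [^]\<^bsub>G\<^esub> n = \<one>\<^bsub>G\<^esub> \<and> s [^]\<^bsub>G\<^esub> (2::nat) = \<one>\<^bsub>G\<^esub> \<and>
     s \<otimes>\<^bsub>G\<^esub> r \<otimes>\<^bsub>G\<^esub> s = inv\<^bsub>G\<^esub> r"

(* The subgroup of order 2 has degree 2^(n-2) + 2 here: its neighbours are the trivial subgroup,
   one subgroup of order 4 generated by a power of x, and 2^(n-2) subgroups of order 4 generated
   by elements outside the powers of x. The value 2^(n-2) + 1 found in print omits one of them;
   it also contradicts the dicyclic case, as this group is dicyclic with parameter 2^(n-2). *)
definition generalized_quaternion ::
  "('a, 'm) monoid_scheme \<Rightarrow> nat \<Rightarrow> 'a \<Rightarrow> 'a \<Rightarrow> bool" where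
  "generalized_quaternion G n x y \<longleftrightarrow>
     group G \<and> x \<in> carrier G \<and> y \<in> carrier G \<and> generate G {x, y} = carrier G \<and>
     order G = 2 ^ n \<and>
     x [^]\<^bsub>G\<^esub> ((2::nat) ^ (n - 1)) = \<one>\<^bsub>G\<^esub> \<and>
     y [^]\<^bsub>G\<^esub> (2::nat) = x [^]\<^bsub>G\<^esub> ((2::nat) ^ (n - 2)) \<and>
     inv\<^bsub>G\<^esub> y \<otimes>\<^bsub>G\<^esub> x \<otimes>\<^bsub>G\<^esub> y = inv\<^bsub>G\<^esub> x"

definition dicyclic :: "('a, 'm) monoid_scheme \<Rightarrow> nat \<Rightarrow> 'a \<Rightarrow> 'a \<Rightarrow> bool" where
  "dicyclic G n x y \<longleftrightarrow>
     group G \<and> x \<in> carrier G \<and> y \<in> carrier G \<and> generate G {x, y} = carrier G \<and>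
     order G = 4 * n \<and>
     x [^]\<^bsub>G\<^esub> (2 * n) = \<one>\<^bsub>G\<^esub> \<and> y [^]\<^bsub>G\<^esub> (2::nat) = x [^]\<^bsub>G\<^esub> n \<and>
     inv\<^bsub>G\<^esub> y \<otimes>\<^bsub>G\<^esub> x \<otimes>\<^bsub>G\<^esub> y = inv\<^bsub>G\<^esub> x"

definition iso_Z2 :: "('a, 'm) monoid_scheme \<Rightarrow> 'a set \<Rightarrow> bool" where
  "iso_Z2 G H \<longleftrightarrow> G\<lparr>carrier := H\<rparr> \<cong> integer_mod_group 2"

definition m_count :: "nat \<Rightarrow> (nat \<Rightarrow> nat) \<Rightarrow> nat" where
  "m_count k b = card {i \<in> {1..k}. b i = 0}"

(* The exponents a are an argument because they must be those of the order of the cyclic group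
   whose subgroup H is: n in the cyclic and dihedral groups, but 2n in the dicyclic group. With
   the exponents of n itself the dicyclic formula fails for even n; for instance the subgroup
   generated by x in the dicyclic group of order 8 has degree 1. *)
definition r_count :: "nat \<Rightarrow> (nat \<Rightarrow> nat) \<Rightarrow> (nat \<Rightarrow> nat) \<Rightarrow> nat" where
  "r_count k a b = card {i \<in> {1..k}. b i = a i}"

end

theory Submission
  imports Defs "HOL-Algebra.Multiplicative_Group"
begin

text \<open>
  In a finite cyclic group of order \<open>N\<close> there is exactly one subgroup of each order dividing \<open>N\<close>,
  and inclusion of subgroups is divisibility of orders. A subgroup is therefore covered by another
  exactly when the orders differ by a prime factor (\<open>covered_by_cyclic_iff\<close>), and a subgroup of
  order \<open>h\<close> has \<open>\<omega>(N / h) + \<omega>(h)\<close> neighbours, where \<open>\<omega>\<close> counts distinct prime factors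
  (\<open>card_neighbours_in_cyclic\<close>). In terms of the exponents \<open>a\<^sub>i\<close> of \<open>N\<close> and \<open>b\<^sub>i\<close> of \<open>h\<close>, a prime
  contributes to the first summand unless \<open>b\<^sub>i = a\<^sub>i\<close>, and to the second unless \<open>b\<^sub>i = 0\<close>; this gives
  \<open>2 k - m(H) - r(H)\<close>.

  The other three families share one structure: a cyclic subgroup \<open>\<langle>x\<rangle>\<close> of index two such that all
  elements outside it have the same square \<open>z\<close>, an element of \<open>\<langle>x\<rangle>\<close> with \<open>z\<^sup>2 = 1\<close>
  (\<open>cyclic_index_two_presentation\<close>). Then a cyclic subgroup not contained in \<open>\<langle>x\<rangle>\<close> has the form
  \<open>{1, z, t, t z}\<close>; its only neighbour is \<open>\<langle>z\<rangle>\<close>, and there are \<open>|\<langle>x\<rangle>| / |\<langle>z\<rangle>|\<close> of them. So the subgroups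
  of \<open>\<langle>x\<rangle>\<close> have the degrees found in the cyclic case, except that \<open>\<langle>z\<rangle>\<close> gains \<open>|\<langle>x\<rangle>| / |\<langle>z\<rangle>|\<close> further
  neighbours (\<open>csg_degree_inner\<close>, \<open>csg_degree_outer\<close>). In the dihedral group of order \<open>2 n\<close>,
  \<open>|\<langle>x\<rangle>| = n\<close> and \<open>z = 1\<close>; in the dicyclic group of order \<open>4 n\<close>, \<open>|\<langle>x\<rangle>| = 2 n\<close> and \<open>z = x\<^sup>n\<close> has order
  two; the generalized quaternion group of order \<open>2\<^sup>n\<close> is dicyclic with parameter \<open>2 ^ (n - 2)\<close>.
\<close>

section \<open>Prime factors of products of prime powers\<close>

lemma prime_factors_prod_prime_powers:
  fixes p e :: "'i \<Rightarrow> nat"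
  assumes "finite I" and "\<And>i. i \<in> I \<Longrightarrow> prime (p i)"
  shows "prime_factors (\<Prod>i\<in>I. p i ^ e i) = p ` {i \<in> I. e i \<noteq> 0}"
proof -
  have nz: "(\<Prod>i\<in>I. p i ^ e i) \<noteq> 0"
    using assms by (auto simp: prime_gt_0_nat)
  have "q \<in> prime_factors (\<Prod>i\<in>I. p i ^ e i) \<longleftrightarrow> q \<in> p ` {i \<in> I. e i \<noteq> 0}" for q
  proof -
    have "q \<in> prime_factors (\<Prod>i\<in>I. p i ^ e i) \<longleftrightarrow> prime q \<and> (\<exists>i\<in>I. q dvd p i ^ e i)"
      using assms(1) nz by (auto simp: in_prime_factors_iff prime_dvd_prod_iff)
    also have "\<dots> \<longleftrightarrow> (\<exists>i\<in>I. e i \<noteq> 0 \<and> q = p i)"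
      using assms(2)
      by (metis bot_nat_0.not_eq_extremum dvd_refl nat_dvd_1_iff_1 not_prime_1 power_0
          prime_dvd_power primes_dvd_imp_eq prime_dvd_power_iff)
    finally show ?thesis by blast
  qed
  then show ?thesis by blast
qed

lemma multiplicity_prod_indexed_prime_powers:
  fixes p e :: "'i \<Rightarrow> nat"
  assumes "finite I" and "\<And>i. i \<in> I \<Longrightarrow> prime (p i)" and "inj_on p I" and "j \<in> I"
  shows "multiplicity (p j) (\<Prod>i\<in>I. p i ^ e i) = e j"
proof -
  have "(\<Prod>i\<in>I. p i ^ e i) = (\<Prod>q\<in>p ` I. q ^ e (the_inv_into I p q))"
    using assms(3) by (simp add: prod.reindex the_inv_into_f_f cong: prod.cong)
  then show ?thesis
    using multiplicity_prod_prime_powers[of "p ` I" "p j" "\<lambda>q. e (the_inv_into I p q)"] assms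
    by (auto simp: the_inv_into_f_f)
qed

text \<open>Both sides count the primes by which a divisor \<open>h\<close> of \<open>n\<close> can be multiplied, or divided,
  so that the result is again a divisor of \<open>n\<close>.\<close>

lemma card_prime_factors_exponents:
  fixes p a b :: "'i \<Rightarrow> nat"
  assumes fin: "finite I" and pr: "\<And>i. i \<in> I \<Longrightarrow> prime (p i)" and inj: "inj_on p I"
    and n: "n = (\<Prod>i\<in>I. p i ^ a i)" and h: "h = (\<Prod>i\<in>I. p i ^ b i)" and dvd: "h dvd n"
  shows "int (card (prime_factors (n div h)) + card (prime_factors h))
     = 2 * int (card I) - int (card {i \<in> I. b i = 0}) - int (card {i \<in> I. b i = a i})"
proof -
  have n0: "n \<noteq> 0"
    unfolding n using fin pr by (auto simp: prime_gt_0_nat)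
  have le: "b i \<le> a i" if "i \<in> I" for i
  proof -
    have "multiplicity (p i) h \<le> multiplicity (p i) n"
      using dvd n0 by (rule dvd_imp_multiplicity_le)
    then show ?thesis
      using multiplicity_prod_indexed_prime_powers[OF fin pr inj that] n h by simp
  qed
  have "n = (\<Prod>i\<in>I. p i ^ (a i - b i)) * h"
    unfolding n h prod.distrib[symmetric]
    by (intro prod.cong refl) (simp add: le flip: power_add)
  moreover have "h \<noteq> 0" using dvd n0 by auto
  ultimately have nh: "n div h = (\<Prod>i\<in>I. p i ^ (a i - b i))" by simp
  have card_compl: "int (card {i \<in> I. \<not> P i}) = int (card I) - int (card {i \<in> I. P i})" for P
  proof -
    have "card I = card ({i \<in> I. \<not> P i} \<union> {i \<in> I. P i})" by (rule arg_cong[of _ _ card]) auto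
    also have "\<dots> = card {i \<in> I. \<not> P i} + card {i \<in> I. P i}"
      using fin by (intro card_Un_disjoint) auto
    finally show ?thesis by simp
  qed
  have pf: "card (prime_factors (\<Prod>i\<in>I. p i ^ e i)) = card {i \<in> I. e i \<noteq> 0}"
    for e :: "'i \<Rightarrow> nat"
  proof -
    have "prime_factors (\<Prod>i\<in>I. p i ^ e i) = p ` {i \<in> I. e i \<noteq> 0}"
      using fin pr by (rule prime_factors_prod_prime_powers)
    moreover have "inj_on p {i \<in> I. e i \<noteq> 0}" using inj by (rule inj_on_subset) auto
    ultimately show ?thesis by (simp add: card_image)
  qed
  have "{i \<in> I. a i - b i \<noteq> 0} = {i \<in> I. b i \<noteq> a i}"
    using le by (force dest: le)
  then have "card (prime_factors (n div h)) = card {i \<in> I. b i \<noteq> a i}"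
    unfolding nh pf by simp
  moreover have "card (prime_factors h) = card {i \<in> I. b i \<noteq> 0}"
    unfolding h pf ..
  ultimately show ?thesis
    using card_compl[of "\<lambda>i. b i = a i"] card_compl[of "\<lambda>i. b i = 0"] by simp
qed

lemma card_prime_factors_power_two: "card (prime_factors ((2::nat) ^ j)) = (if j = 0 then 0 else 1)"
  by (simp add: prime_factorization_prime_power)

section \<open>Subgroups of a finite cyclic group\<close>

context group
begin

lemma cyclic_subgroups_subgroup:
  "H \<in> cyclic_subgroups G \<Longrightarrow> subgroup H G"
  by (auto simp: cyclic_subgroups_def intro: generate_is_subgroup)

lemma card_dvd_card_subgroup:
  assumes "subgroup H G" "subgroup K G" "H \<subseteq> K"
  shows "card H dvd card K"
proof -
  interpret K: group "G\<lparr>carrier := K\<rparr>" using assms(2) by (rule subgroup_imp_group)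
  have "subgroup H (G\<lparr>carrier := K\<rparr>)"
    using assms by (simp add: subgroup_incl)
  then show ?thesis
    using K.lagrange[of H] by (simp add: order_def) (metis dvd_triv_right)
qed

lemma pow_card_subgroup:
  assumes "subgroup H G" "u \<in> H"
  shows "u [^] card H = \<one>"
proof -
  interpret H: group "G\<lparr>carrier := H\<rparr>" using assms(1) by (rule subgroup_imp_group)
  show ?thesis
    using H.pow_order_eq_1[of u] assms by (simp add: order_def flip: nat_pow_consistent)
qed

context
  fixes x
  assumes fin: "finite (carrier G)" and x: "x \<in> carrier G"
begin

lemma card_generate_pow_div:
  assumes "d dvd ord x"
  shows "card (generate G {x [^] (ord x div d)}) = d"
proof -
  have "ord x \<noteq> 0" using ord_ge_1[OF fin x] by simp
  then have "ord (x [^] (ord x div d)) = d"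
    using assms x by (subst ord_pow) (auto elim!: dvdE)
  then show ?thesis using generate_pow_card[of "x [^] (ord x div d)"] x by simp
qed

lemma generate_pow_subset: "generate G {x [^] (k::nat)} \<subseteq> generate G {x}"
proof (rule generate_subgroup_incl)
  show "subgroup (generate G {x}) G" using x by (simp add: generate_is_subgroup)
  show "{x [^] k} \<subseteq> generate G {x}" using generate_pow_on_finite_carrier[OF fin x] by blast
qed

text \<open>A subgroup of order \<open>h\<close> consists of solutions of \<open>u\<^sup>h = 1\<close>, and in a cyclic group these
  solutions form a single subgroup of order \<open>h\<close>.\<close>

lemma subgroup_of_cyclic:
  assumes H: "subgroup H G" and sub: "H \<subseteq> generate G {x}"
  shows "card H dvd ord x" and "H = generate G {x [^] (ord x div card H)}"
proof -
  let ?h = "card H" and ?N = "ord x"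
  have C: "subgroup (generate G {x}) G" using x by (simp add: generate_is_subgroup)
  show dvd: "?h dvd ?N"
    using card_dvd_card_subgroup[OF H C sub] generate_pow_card[OF x] by simp
  have N: "?N \<noteq> 0" using ord_ge_1[OF fin x] by simp
  let ?y = "x [^] (?N div ?h)"
  have y: "?y \<in> carrier G" using x by simp
  have h: "?h \<noteq> 0" using dvd N by auto
  have "H \<subseteq> generate G {?y}"
  proof
    fix u assume u: "u \<in> H"
    then obtain i :: nat where i: "u = x [^] i"
      using sub generate_pow_on_finite_carrier[OF fin x] by blast
    have "x [^] (i * ?h) = \<one>"
      using pow_card_subgroup[OF H u] x by (simp add: i nat_pow_pow)
    then have "?N dvd i * ?h" using x by (simp add: pow_eq_id)
    then have "?N div ?h dvd i" using dvd h by (simp add: div_dvd_iff_mult)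
    then obtain j where "i = (?N div ?h) * j" by blast
    then have "u = ?y [^] j" using x by (simp add: i nat_pow_pow)
    then show "u \<in> generate G {?y}"
      using generate_pow_on_finite_carrier[OF fin y] by blast
  qed
  moreover have "card (generate G {?y}) = ?h" by (rule card_generate_pow_div[OF dvd])
  moreover have "finite (generate G {?y})"
    using generate_incl[of "{?y}"] y fin by (auto intro: finite_subset)
  ultimately show "H = generate G {?y}" by (simp add: card_subset_eq)
qed

lemma subgroup_of_cyclic_in_cyclic_subgroups:
  assumes "subgroup H G" "H \<subseteq> generate G {x}"
  shows "H \<in> cyclic_subgroups G"
  using subgroup_of_cyclic(2)[OF assms] x unfolding cyclic_subgroups_def by blast

lemma subgroup_of_cyclic_eqI:
  assumes "subgroup H G" "H \<subseteq> generate G {x}" "subgroup K G" "K \<subseteq> generate G {x}"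
    and "card H = card K"
  shows "H = K"
  using subgroup_of_cyclic(2) assms by metis

lemma subgroup_of_cyclic_subset_iff:
  assumes H: "subgroup H G" "H \<subseteq> generate G {x}" and K: "subgroup K G" "K \<subseteq> generate G {x}"
  shows "H \<subseteq> K \<longleftrightarrow> card H dvd card K"
proof
  assume "H \<subseteq> K"
  then show "card H dvd card K" using card_dvd_card_subgroup H K by blast
next
  let ?N = "ord x"
  assume "card H dvd card K"
  then obtain m where m: "card K = card H * m" by blast
  have N: "?N \<noteq> 0" using ord_ge_1[OF fin x] by simp
  obtain l where l: "?N = card K * l" using subgroup_of_cyclic(1)[OF K] by blast
  have nz: "card H \<noteq> 0" "card K \<noteq> 0" using N l m by auto
  have "?N div card H = l * m" "?N div card K = l" using nz by (simp_all add: l, simp add: m)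
  then have HK: "H = generate G {x [^] (l * m)}" "K = generate G {x [^] l}"
    using subgroup_of_cyclic(2)[OF H] subgroup_of_cyclic(2)[OF K] by simp_all
  have "(x [^] l) [^] m \<in> generate G {x [^] l}"
    using generate_pow_on_finite_carrier[OF fin, of "x [^] l"] x by blast
  then have "{x [^] (l * m)} \<subseteq> K" using x by (simp add: HK nat_pow_pow)
  then show "H \<subseteq> K" unfolding HK(1) using K(1) by (rule generate_subgroup_incl)
qed

lemma covered_by_cyclic_iff:
  assumes H: "subgroup H G" "H \<subseteq> generate G {x}" and K: "subgroup K G" "K \<subseteq> generate G {x}"
  shows "covered_by G H K \<longleftrightarrow> (\<exists>q. prime q \<and> card K = q * card H)"
proof -
  let ?N = "ord x"
  have N: "?N \<noteq> 0" using ord_ge_1[OF fin x] by simp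
  have Kd: "card K dvd ?N" and Hd: "card H dvd ?N"
    using subgroup_of_cyclic(1) H K by blast+
  then have nz: "card K \<noteq> 0" "card H \<noteq> 0" using N by auto
  then have finK: "finite K" by (simp add: card_gt_0_iff)
  show ?thesis
  proof
    assume cov: "covered_by G H K"
    then have HK: "H \<subset> K" by (simp add: covered_by_def)
    then have "card H dvd card K" using subgroup_of_cyclic_subset_iff[OF H K] by blast
    then obtain m where m: "card K = card H * m" by blast
    have "card H < card K" using HK finK by (simp add: psubset_card_mono)
    then have "m \<noteq> 1" using m by auto
    then obtain q where q: "prime q" "q dvd m" using prime_factor_nat by blast
    \<comment> \<open>The subgroup of order \<open>q\<close> times that of \<open>H\<close> lies strictly above \<open>H\<close>, hence equals \<open>K\<close>.\<close>
    define L where "L = generate G {x [^] (?N div (q * card H))}"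
    have d: "q * card H dvd card K" using q(2) m by (simp add: mult.commute)
    have cardL: "card L = q * card H"
      unfolding L_def using d Kd by (intro card_generate_pow_div) (rule dvd_trans)
    have L: "subgroup L G" "L \<subseteq> generate G {x}"
      unfolding L_def using x generate_pow_subset by (auto intro: generate_is_subgroup)
    have "H \<subseteq> L" "L \<subseteq> K"
      using subgroup_of_cyclic_subset_iff[OF H L] subgroup_of_cyclic_subset_iff[OF L K] cardL d
      by auto
    moreover have "H \<noteq> L" using cardL nz prime_gt_1_nat[OF q(1)] by auto
    ultimately have "L = K" using cov L(1) unfolding covered_by_def by blast
    then show "\<exists>q. prime q \<and> card K = q * card H" using q cardL by blast
  next
    assume "\<exists>q. prime q \<and> card K = q * card H"
    then obtain q where q: "prime q" "card K = q * card H" by blast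
    have "H \<subseteq> K" using subgroup_of_cyclic_subset_iff[OF H K] q by simp
    moreover have "H \<noteq> K" using q nz prime_gt_1_nat[OF q(1)] by auto
    moreover have False if L: "subgroup L G" "H \<subset> L" "L \<subset> K" for L
    proof -
      obtain m where m: "card L = card H * m"
        using card_dvd_card_subgroup[OF H(1) L(1)] L(2) by blast
      obtain l where l: "card K = card L * l"
        using card_dvd_card_subgroup[OF L(1) K(1)] L(3) by blast
      have lt: "card L < card K" "card H < card L"
        using L finK by (auto intro!: psubset_card_mono intro: finite_subset)
      have "q = m * l" using q(2) m l nz by simp
      then have "m = 1 \<or> l = 1" using q(1) by (metis prime_product)
      then show False using lt m l by auto
    qed
    ultimately show "covered_by G H K" unfolding covered_by_def by blast
  qed
qed

text \<open>The neighbours of \<open>H\<close> inside \<open>\<langle>x\<rangle>\<close> have order \<open>q |H|\<close> with \<open>q\<close> a prime factor of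
  \<open>ord x / |H|\<close>, or \<open>|H| / q\<close> with \<open>q\<close> a prime factor of \<open>|H|\<close>.\<close>

lemma card_neighbours_in_cyclic:
  assumes H: "subgroup H G" "H \<subseteq> generate G {x}"
  shows "finite {K. K \<subseteq> generate G {x} \<and> csg_adj G H K}"
    and "card {K. K \<subseteq> generate G {x} \<and> csg_adj G H K}
      = card (prime_factors (ord x div card H)) + card (prime_factors (card H))"
proof -
  let ?C = "generate G {x}" and ?N = "ord x" and ?h = "card H"
  define S where "S d = generate G {x [^] (?N div d)}" for d
  have N: "?N \<noteq> 0" using ord_ge_1[OF fin x] by simp
  have hN: "?h dvd ?N" using subgroup_of_cyclic(1)[OF H] .
  have h0: "?h \<noteq> 0" using hN N by auto
  have S: "subgroup (S d) G" "S d \<subseteq> ?C" for d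
    unfolding S_def using x generate_pow_subset by (auto intro: generate_is_subgroup)
  have cardS: "card (S d) = d" if "d dvd ?N" for d
    unfolding S_def using that by (rule card_generate_pow_div)
  have KS: "K = S (card K)" "card K dvd ?N" if "subgroup K G" "K \<subseteq> ?C" for K
    unfolding S_def using subgroup_of_cyclic[OF that] by auto
  let ?U = "{K. subgroup K G \<and> K \<subseteq> ?C \<and> covered_by G H K}"
  let ?D = "{K. subgroup K G \<and> K \<subseteq> ?C \<and> covered_by G K H}"
  have up: "q * ?h dvd ?N" if "q \<in> prime_factors (?N div ?h)" for q
    using that hN h0 by (auto simp: dvd_div_iff_mult in_prime_factors_iff)
  have down: "?h div q dvd ?N" "?h = q * (?h div q)" if "q \<in> prime_factors ?h" for q
  proof -
    have qh: "q dvd ?h" using that by auto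
    then show "?h = q * (?h div q)" by simp
    then show "?h div q dvd ?N" using hN by (metis dvd_mult_right)
  qed
  have U: "?U = (\<lambda>q. S (q * ?h)) ` prime_factors (?N div ?h)" (is "_ = ?U'")
  proof
    show "?U \<subseteq> ?U'"
    proof
      fix K assume "K \<in> ?U"
      then have K: "subgroup K G" "K \<subseteq> ?C" "covered_by G H K" by auto
      then obtain q where q: "prime q" "card K = q * ?h"
        using covered_by_cyclic_iff[OF H K(1,2)] by blast
      have "q * ?h dvd ?N" using KS(2)[OF K(1,2)] q by simp
      then have "q dvd ?N div ?h" using hN h0 by (simp add: dvd_div_iff_mult)
      moreover have "?N div ?h \<noteq> 0" using hN N by (simp add: dvd_div_eq_0_iff)
      ultimately have "q \<in> prime_factors (?N div ?h)" using q(1) by (simp add: in_prime_factors_iff)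
      then show "K \<in> ?U'" using KS(1)[OF K(1,2)] q(2) by auto
    qed
    show "?U' \<subseteq> ?U"
    proof
      fix K assume "K \<in> ?U'"
      then obtain q where q: "q \<in> prime_factors (?N div ?h)" "K = S (q * ?h)" by auto
      have "card K = q * ?h" using cardS[OF up[OF q(1)]] q by simp
      moreover have "prime q" using q(1) by auto
      ultimately show "K \<in> ?U" using covered_by_cyclic_iff[OF H S] S q(2) by blast
    qed
  qed
  have D: "?D = (\<lambda>q. S (?h div q)) ` prime_factors ?h" (is "_ = ?D'")
  proof
    show "?D \<subseteq> ?D'"
    proof
      fix K assume "K \<in> ?D"
      then have K: "subgroup K G" "K \<subseteq> ?C" "covered_by G K H" by auto
      then obtain q where q: "prime q" "?h = q * card K"
        using covered_by_cyclic_iff[OF K(1,2) H] by blast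
      have "q \<in> prime_factors ?h" using q h0 by (auto simp: in_prime_factors_iff)
      moreover have "card K = ?h div q" using q prime_gt_0_nat[OF q(1)] by simp
      ultimately show "K \<in> ?D'" using KS(1)[OF K(1,2)] by auto
    qed
    show "?D' \<subseteq> ?D"
    proof
      fix K assume "K \<in> ?D'"
      then obtain q where q: "q \<in> prime_factors ?h" "K = S (?h div q)" by auto
      have "?h = q * card K" using cardS[OF down(1)[OF q(1)]] down(2)[OF q(1)] q(2) by simp
      moreover have "prime q" using q(1) by auto
      ultimately show "K \<in> ?D" using covered_by_cyclic_iff[OF S H] S q(2) by blast
    qed
  qed
  have "inj_on (\<lambda>q. S (q * ?h)) (prime_factors (?N div ?h))"
  proof (rule inj_onI)
    fix q r assume qr: "q \<in> prime_factors (?N div ?h)" "r \<in> prime_factors (?N div ?h)"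
      "S (q * ?h) = S (r * ?h)"
    then have "q * ?h = r * ?h" using cardS up by metis
    then show "q = r" using h0 by simp
  qed
  then have cU: "card ?U = card (prime_factors (?N div ?h))" unfolding U by (rule card_image)
  have "inj_on (\<lambda>q. S (?h div q)) (prime_factors ?h)"
  proof (rule inj_onI)
    fix q r assume qr: "q \<in> prime_factors ?h" "r \<in> prime_factors ?h"
      "S (?h div q) = S (?h div r)"
    then have "?h div q = ?h div r" using cardS down by metis
    then show "q = r" using down(2)[OF qr(1)] down(2)[OF qr(2)] h0
      by (metis mult_cancel2 mult_is_0)
  qed
  then have cD: "card ?D = card (prime_factors ?h)" unfolding D by (rule card_image)
  have eq: "{K. K \<subseteq> ?C \<and> csg_adj G H K} = ?U \<union> ?D"
    using subgroup_of_cyclic_in_cyclic_subgroups cyclic_subgroups_subgroup H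
    unfolding csg_adj_def by blast
  have finU: "finite ?U" unfolding U by simp
  have finD: "finite ?D" unfolding D by simp
  show "finite {K. K \<subseteq> ?C \<and> csg_adj G H K}" unfolding eq using finU finD by blast
  have "?U \<inter> ?D = {}" unfolding covered_by_def by blast
  then show "card {K. K \<subseteq> ?C \<and> csg_adj G H K}
      = card (prime_factors (?N div ?h)) + card (prime_factors ?h)"
    unfolding eq using finU finD cU cD by (simp add: card_Un_disjoint)
qed

end

end

section \<open>Groups with a cyclic subgroup of index two and constant outer squares\<close>

text \<open>A finite group with a cyclic subgroup \<open>\<langle>x\<rangle>\<close> of index two such that all elements outside
  \<open>\<langle>x\<rangle>\<close> have the same square \<open>z\<close>, where \<open>z \<in> \<langle>x\<rangle>\<close> and \<open>z\<^sup>2 = 1\<close>. Dihedral groups are of this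
  kind with \<open>z = 1\<close>, dicyclic groups with \<open>z\<close> of order two.\<close>

locale cyclic_index_two = group G for G (structure) +
  fixes x z
  assumes fin: "finite (carrier G)"
    and x: "x \<in> carrier G"
    and order_eq: "order G = 2 * ord x"
    and z: "z \<in> generate G {x}"
    and zz: "z \<otimes> z = \<one>"
    and outer_square: "t \<in> carrier G \<Longrightarrow> t \<notin> generate G {x} \<Longrightarrow> t \<otimes> t = z"
begin

text \<open>The distinguished cyclic subgroup.\<close>

abbreviation "C \<equiv> generate G {x}"

lemma C_subgroup: "subgroup C G"
  using x by (simp add: generate_is_subgroup)

lemma C_subset: "C \<subseteq> carrier G"
  using C_subgroup by (rule subgroup.subset)

lemma z_carrier: "z \<in> carrier G"
  using z C_subset by blast

lemma generate_z: "generate G {z} = {\<one>, z}"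
proof
  have "z [^] k \<in> {\<one>, z}" for k :: nat
    by (induction k) (use zz z_carrier in auto)
  then show "generate G {z} \<subseteq> {\<one>, z}"
    unfolding generate_pow_on_finite_carrier[OF fin z_carrier] by auto
qed (auto intro: generate.one generate.incl)

text \<open>The powers of an element \<open>t\<close> outside \<open>\<langle>x\<rangle>\<close> are \<open>1, t, z, t z\<close>; the even ones lie in \<open>\<langle>x\<rangle>\<close>, and
  each odd one generates \<open>\<langle>t\<rangle>\<close> again.\<close>

lemma outer_pow:
  assumes t: "t \<in> carrier G" "t \<notin> C"
  shows "t [^] (k::nat) \<in> (if even k then {\<one>, z} else {t, t \<otimes> z})"
proof (induction k)
  case (Suc k)
  have tt: "t \<otimes> t = z" using outer_square t .
  have "z \<otimes> t = t \<otimes> z" using t by (simp add: m_assoc flip: tt)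
  then have "t \<otimes> z \<otimes> t = \<one>"
    using t z_carrier zz tt by (metis m_assoc)
  then show ?case
    using Suc tt t z_carrier \<open>z \<otimes> t = t \<otimes> z\<close> by (auto split: if_splits)
qed simp

lemma generate_outer:
  assumes t: "t \<in> carrier G" "t \<notin> C"
  shows "generate G {t} = {\<one>, z, t, t \<otimes> z}"
proof
  have "t [^] k \<in> {\<one>, z, t, t \<otimes> z}" for k :: nat
    using outer_pow[OF t, of k] by (auto split: if_splits)
  then show "generate G {t} \<subseteq> {\<one>, z, t, t \<otimes> z}"
    unfolding generate_pow_on_finite_carrier[OF fin t(1)] by auto
  have "t \<in> generate G {t}" by (simp add: generate.incl)
  moreover from this have "z \<in> generate G {t}"
    using outer_square[OF t] generate.eng by metis
  ultimately show "{\<one>, z, t, t \<otimes> z} \<subseteq> generate G {t}"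
    by (auto intro: generate.one generate.eng)
qed

lemma outer_mult_z:
  assumes t: "t \<in> carrier G" "t \<notin> C"
  shows "t \<otimes> z \<in> carrier G" "t \<otimes> z \<notin> C" "t \<otimes> z \<otimes> z = t"
proof -
  show "t \<otimes> z \<in> carrier G" using t z_carrier by simp
  show tzz: "t \<otimes> z \<otimes> z = t" using t z_carrier zz by (simp add: m_assoc)
  show "t \<otimes> z \<notin> C"
  proof
    assume "t \<otimes> z \<in> C"
    then have "t \<otimes> z \<otimes> z \<in> C" using z by (rule generate.eng)
    then show False using tzz t by simp
  qed
qed

lemma generate_outer_diff:
  assumes "t \<in> carrier G" "t \<notin> C"
  shows "generate G {t} - C = {t, t \<otimes> z}" and "generate G {t} \<inter> C = {\<one>, z}"
  using assms z outer_mult_z[OF assms] generate_outer[OF assms] by (auto intro: generate.one)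

lemma generate_outer_eq:
  assumes t: "t \<in> carrier G" "t \<notin> C" and u: "u \<in> generate G {t}" "u \<notin> C"
  shows "generate G {u} = generate G {t}"
proof -
  have "u = t \<or> u = t \<otimes> z" using generate_outer_diff(1)[OF t] u by blast
  then show ?thesis
    using generate_outer[OF t] generate_outer[OF outer_mult_z(1,2)[OF t]] outer_mult_z(3)[OF t]
    by auto
qed

lemma card_generate_outer_diff:
  assumes t: "t \<in> carrier G" "t \<notin> C"
  shows "card (generate G {t} - C) = ord z"
proof -
  have "t = t \<otimes> z \<longleftrightarrow> \<one> = z"
    using t z_carrier by (metis l_cancel_one' r_cancel_one')
  then have "card {t, t \<otimes> z} = card {\<one>, z}" by (cases "z = \<one>") auto
  then show ?thesis
    unfolding generate_outer_diff(1)[OF t] generate_pow_card[OF z_carrier] generate_z .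
qed

lemma outer_cyclic_subgroup_cases:
  assumes "K \<in> cyclic_subgroups G" "\<not> K \<subseteq> C"
  obtains t where "t \<in> carrier G" "t \<notin> C" "K = generate G {t}"
proof -
  obtain g where g: "g \<in> carrier G" "K = generate G {g}"
    using assms(1) by (auto simp: cyclic_subgroups_def)
  moreover have "g \<notin> C"
    using generate_subgroup_incl[OF _ C_subgroup, of "{g}"] g assms(2) by auto
  ultimately show thesis using that by blast
qed

text \<open>Every element outside \<open>\<langle>x\<rangle>\<close> lies in exactly one cyclic subgroup not contained in \<open>\<langle>x\<rangle>\<close>,
  and each of these has as many elements outside \<open>\<langle>x\<rangle>\<close> as \<open>z\<close> has powers.\<close>

lemma card_outer_cyclic_subgroups:
  shows "finite {K \<in> cyclic_subgroups G. \<not> K \<subseteq> C}"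
    and "card {K \<in> cyclic_subgroups G. \<not> K \<subseteq> C} = ord x div ord z"
proof -
  let ?O = "{K \<in> cyclic_subgroups G. \<not> K \<subseteq> C}"
  let ?f = "\<lambda>K. K - C"
  have "?O \<subseteq> Pow (carrier G)"
    using cyclic_subgroups_subgroup subgroup.subset by blast
  then show finO: "finite ?O" using fin by (metis finite_Pow_iff finite_subset)
  have cardf: "card (?f K) = ord z" if "K \<in> ?O" for K
    using that card_generate_outer_diff by (auto elim: outer_cyclic_subgroup_cases)
  have disj: "?f K \<inter> ?f L = {}" if KL: "K \<in> ?O" "L \<in> ?O" "K \<noteq> L" for K L
  proof (rule ccontr)
    assume "?f K \<inter> ?f L \<noteq> {}"
    then obtain u where u: "u \<in> K" "u \<in> L" "u \<notin> C" by blast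
    obtain t where t: "t \<in> carrier G" "t \<notin> C" "K = generate G {t}"
      using KL(1) by (auto elim: outer_cyclic_subgroup_cases)
    obtain s where s: "s \<in> carrier G" "s \<notin> C" "L = generate G {s}"
      using KL(2) by (auto elim: outer_cyclic_subgroup_cases)
    show False
      using generate_outer_eq[OF t(1,2)] generate_outer_eq[OF s(1,2)] u t(3) s(3) KL(3) by metis
  qed
  have union: "(\<Union>K\<in>?O. ?f K) = carrier G - C"
  proof
    show "(\<Union>K\<in>?O. ?f K) \<subseteq> carrier G - C"
      using cyclic_subgroups_subgroup subgroup.subset by blast
    show "carrier G - C \<subseteq> (\<Union>K\<in>?O. ?f K)"
    proof
      fix t assume t: "t \<in> carrier G - C"
      moreover have "t \<in> generate G {t}" by (simp add: generate.incl)
      ultimately show "t \<in> (\<Union>K\<in>?O. ?f K)"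
        unfolding cyclic_subgroups_def by blast
    qed
  qed
  have finC: "finite C" using C_subset fin by (rule finite_subset)
  have "card (carrier G - C) = order G - card C"
    using C_subset finC by (simp add: card_Diff_subset order_def)
  also have "\<dots> = ord x" using order_eq generate_pow_card[OF x] by simp
  finally have "ord x = card (\<Union>K\<in>?O. ?f K)" using union by simp
  also have "\<dots> = (\<Sum>K\<in>?O. card (?f K))"
  proof (rule card_UN_disjoint[OF finO])
    show "\<forall>K\<in>?O. finite (?f K)"
      using union by (intro ballI finite_subset[OF _ fin]) blast
    show "\<forall>K\<in>?O. \<forall>L\<in>?O. K \<noteq> L \<longrightarrow> ?f K \<inter> ?f L = {}" using disj by blast
  qed
  also have "\<dots> = card ?O * ord z" using cardf by simp
  finally show "card ?O = ord x div ord z"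
    using ord_ge_1[OF fin z_carrier] by simp
qed

lemma card_outer_cyclic_subgroup:
  assumes "K \<in> cyclic_subgroups G" "\<not> K \<subseteq> C"
  shows "card K = 2 * ord z"
proof -
  obtain t where t: "t \<in> carrier G" "t \<notin> C" "K = generate G {t}"
    using assms by (rule outer_cyclic_subgroup_cases)
  have "finite K"
    using cyclic_subgroups_subgroup[OF assms(1)] fin by (metis finite_subset subgroup.subset)
  then have "card K = card (K - C) + card (K \<inter> C)"
    by (metis card_Diff_subset_Int card_mono Int_lower1 finite_Int le_add_diff_inverse2)
  then show ?thesis
    using card_generate_outer_diff[OF t(1,2)] generate_outer_diff(2)[OF t(1,2)] t(3)
      generate_pow_card[OF z_carrier] generate_z by simp
qed

text \<open>A cyclic subgroup not contained in \<open>\<langle>x\<rangle>\<close> is maximal among the cyclic subgroups, and \<open>\<langle>z\<rangle>\<close> is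
  the only one that it covers; so it is a leaf of the graph, attached to \<open>\<langle>z\<rangle>\<close>.\<close>

lemma covered_by_outer_iff:
  assumes H: "H \<in> cyclic_subgroups G" and K: "K \<in> cyclic_subgroups G" "\<not> K \<subseteq> C"
  shows "covered_by G H K \<longleftrightarrow> H = generate G {z}" and "\<not> covered_by G K H"
proof -
  obtain t where t: "t \<in> carrier G" "t \<notin> C" "K = generate G {t}"
    using K by (rule outer_cyclic_subgroup_cases)
  have Z: "subgroup (generate G {z}) G" using z_carrier by (simp add: generate_is_subgroup)
  have ZK: "generate G {z} \<subset> K"
    using generate_z generate_outer_diff[OF t(1,2)] t(3) z K(2) by (auto intro: generate.one)
  \<comment> \<open>Proper subgroups of \<open>K\<close> stay inside \<open>\<langle>x\<rangle>\<close>, since any element of \<open>K\<close> outside generates \<open>K\<close>.\<close>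
  have below: "L \<subseteq> generate G {z}" if L: "subgroup L G" "L \<subset> K" for L
  proof -
    have "L \<subseteq> C"
    proof (rule ccontr)
      assume "\<not> L \<subseteq> C"
      then obtain u where u: "u \<in> L" "u \<notin> C" by blast
      then have "K = generate G {u}" using generate_outer_eq[OF t(1,2)] t(3) L(2) by blast
      also have "\<dots> \<subseteq> L" using u L(1) by (intro generate_subgroup_incl) auto
      finally show False using L(2) by blast
    qed
    then show ?thesis using L(2) generate_outer_diff(2)[OF t(1,2)] t(3) generate_z by blast
  qed
  show "covered_by G H K \<longleftrightarrow> H = generate G {z}"
  proof
    assume cov: "covered_by G H K"
    then have "H \<subseteq> generate G {z}"
      using below cyclic_subgroups_subgroup[OF H] by (simp add: covered_by_def)
    then show "H = generate G {z}" using cov Z ZK unfolding covered_by_def by blast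
  next
    assume "H = generate G {z}"
    then show "covered_by G H K" using ZK below unfolding covered_by_def by blast
  qed
  show "\<not> covered_by G K H"
  proof
    assume "covered_by G K H"
    then have KH: "K \<subset> H" by (simp add: covered_by_def)
    then obtain u where u: "u \<in> carrier G" "u \<notin> C" "H = generate G {u}"
      using K(2) H by (metis outer_cyclic_subgroup_cases psubset_imp_subset subset_trans)
    have "t \<in> H" using KH t(3) generate.incl[of t "{t}" G] by blast
    then have "K = H" using generate_outer_eq[OF u(1,2)] t u(3) by blast
    then show False using KH by blast
  qed
qed

lemma generate_z_cyclic: "generate G {z} \<in> cyclic_subgroups G" "generate G {z} \<subseteq> C"
  using z_carrier generate_z z by (auto simp: cyclic_subgroups_def intro: generate.one)

lemma csg_degree_outer:
  assumes "H \<in> cyclic_subgroups G" "\<not> H \<subseteq> C"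
  shows "csg_degree G H = 1"
proof -
  have "{K. csg_adj G H K} = {generate G {z}}"
    unfolding csg_adj_def using covered_by_outer_iff[OF _ assms] generate_z_cyclic assms by blast
  then show ?thesis by (simp add: csg_degree_def)
qed

lemma csg_degree_inner:
  assumes H: "H \<in> cyclic_subgroups G" "H \<subseteq> C"
  shows "csg_degree G H = card (prime_factors (ord x div card H)) + card (prime_factors (card H))
    + (if H = generate G {z} then ord x div ord z else 0)"
proof -
  let ?I = "{K. K \<subseteq> C \<and> csg_adj G H K}"
  let ?O = "{K \<in> cyclic_subgroups G. \<not> K \<subseteq> C}"
  let ?O' = "if H = generate G {z} then ?O else {}"
  note inner = card_neighbours_in_cyclic[OF fin x cyclic_subgroups_subgroup[OF H(1)] H(2)]
  have "{K. csg_adj G H K} = ?I \<union> ?O'"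
    unfolding csg_adj_def using covered_by_outer_iff[OF H(1)] H(1) by auto
  moreover have "?I \<inter> ?O' = {}" by auto
  moreover have "finite ?O'" using card_outer_cyclic_subgroups(1) by simp
  ultimately have "csg_degree G H = card ?I + card ?O'"
    using inner(1) by (simp add: csg_degree_def card_Un_disjoint)
  then show ?thesis
    using inner(2) card_outer_cyclic_subgroups(2) by simp
qed

end

section \<open>Recognition from presentations\<close>

text \<open>The relation lets every element be written as \<open>c\<close> or \<open>c y\<close> with \<open>c \<in> \<langle>x\<rangle>\<close>; the order then
  forces \<open>\<langle>x\<rangle>\<close> to have index two, and \<open>(c y)\<^sup>2 = c c\<^sup>-\<^sup>1 y\<^sup>2 = y\<^sup>2\<close>.\<close>

lemma (in group) cyclic_index_two_presentation:
  assumes x: "x \<in> carrier G" and y: "y \<in> carrier G" and gen: "generate G {x, y} = carrier G"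
    and order: "order G = 2 * N" and N: "N > 0" and xN: "x [^] N = \<one>"
    and yy: "y \<otimes> y \<in> generate G {x}" and y4: "(y \<otimes> y) \<otimes> (y \<otimes> y) = \<one>"
    and xy: "x \<otimes> y = y \<otimes> inv x"
  shows "ord x = N" and "y \<notin> generate G {x}" and "cyclic_index_two G x (y \<otimes> y)"
proof -
  let ?C = "generate G {x}"
  let ?S = "?C \<union> (\<lambda>c. c \<otimes> y) ` ?C"
  have fin: "finite (carrier G)"
    using order N by (intro card_ge_0_finite) (simp add: order_def)
  have C: "subgroup ?C G" using x by (simp add: generate_is_subgroup)
  note CG = subgroup.mem_carrier[OF C] and Cm = subgroup.m_closed[OF C]
    and Ci = subgroup.m_inv_closed[OF C]
  have Ccomm: "c \<otimes> d = d \<otimes> c" if cd: "c \<in> ?C" "d \<in> ?C" for c d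
  proof -
    obtain i j :: nat where "c = x [^] i" "d = x [^] j"
      using cd unfolding generate_pow_on_finite_carrier[OF fin x] by blast
    then show ?thesis using x by (simp add: nat_pow_mult add.commute)
  qed
  have conj: "c \<otimes> y = y \<otimes> inv c" if "c \<in> ?C" for c
  proof -
    have "x [^] i \<otimes> y = y \<otimes> inv (x [^] i)" for i :: nat
    proof (induction i)
      case (Suc i)
      have "x [^] Suc i \<otimes> y = x [^] i \<otimes> (x \<otimes> y)" using x y by (simp add: m_assoc)
      also have "\<dots> = (x [^] i \<otimes> y) \<otimes> inv x" using x y by (simp add: xy m_assoc)
      also have "\<dots> = y \<otimes> inv (x \<otimes> x [^] i)" using x y by (simp add: Suc m_assoc inv_mult_group)
      also have "x \<otimes> x [^] i = x [^] Suc i" using x by (metis nat_pow_Suc2)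
      finally show ?case .
    qed (use y in simp)
    then show ?thesis using that unfolding generate_pow_on_finite_carrier[OF fin x] by blast
  qed
  have conj': "y \<otimes> c = inv c \<otimes> y" if "c \<in> ?C" for c
    using conj[OF Ci[OF that]] CG[OF that] by simp
  have xC: "x \<in> ?C" by (simp add: generate.incl)
  have oneC: "\<one> \<in> ?C" by (rule generate.one)
  have mult1: "(c \<otimes> y) \<otimes> d = (c \<otimes> inv d) \<otimes> y" if "c \<in> ?C" "d \<in> ?C" for c d
    using that CG y conj'[OF that(2)] by (simp add: m_assoc)
  have mult2: "(c \<otimes> y) \<otimes> (d \<otimes> y) = (c \<otimes> inv d) \<otimes> (y \<otimes> y)" if "c \<in> ?C" "d \<in> ?C" for c d
  proof -
    have "(c \<otimes> y) \<otimes> (d \<otimes> y) = ((c \<otimes> y) \<otimes> d) \<otimes> y" using that CG y by (simp add: m_assoc)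
    also have "\<dots> = (c \<otimes> inv d) \<otimes> (y \<otimes> y)"
      unfolding mult1[OF that] using that CG y by (simp add: m_assoc)
    finally show ?thesis .
  qed
  have "carrier G \<subseteq> ?S"
  proof
    fix g assume "g \<in> carrier G"
    then have "g \<in> generate G {x, y}" using gen by simp
    then show "g \<in> ?S"
    proof (induction rule: generate.induct)
      case one then show ?case using oneC by blast
    next
      case (incl h)
      then show ?case using xC oneC y by (auto intro!: image_eqI[of _ _ "\<one>"])
    next
      case (inv h)
      have "inv y = inv (y \<otimes> y) \<otimes> y"
        using y by (simp add: inv_mult_group m_assoc)
      then have "inv y \<in> ?S" using Ci[OF yy] by blast
      then show ?case using inv Ci[OF xC] by blast
    next
      case (eng g h)
      have "c \<otimes> d \<in> ?S" if "c \<in> ?C" "d \<in> ?C" for c d using that Cm by blast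
      moreover have "c \<otimes> (d \<otimes> y) \<in> ?S" if "c \<in> ?C" "d \<in> ?C" for c d
        using that CG y Cm[OF that] by (auto simp flip: m_assoc)
      moreover have "(c \<otimes> y) \<otimes> d \<in> ?S" if "c \<in> ?C" "d \<in> ?C" for c d
        using mult1[OF that] Cm[OF that(1) Ci[OF that(2)]] by auto
      moreover have "(c \<otimes> y) \<otimes> (d \<otimes> y) \<in> ?S" if "c \<in> ?C" "d \<in> ?C" for c d
        using mult2[OF that] Cm[OF Cm[OF that(1) Ci[OF that(2)]] yy] by auto
      ultimately show ?case using eng.IH by blast
    qed
  qed
  then have S: "carrier G = ?S" using CG y by auto
  have finC: "finite ?C" using C fin by (metis finite_subset subgroup.subset)
  have cardC: "card ?C = ord x" using generate_pow_card[OF x] by simp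
  have "ord x dvd N" using xN x by (simp add: pow_eq_id)
  then have le: "ord x \<le> N" using N by (rule dvd_imp_le)
  have "order G \<le> card ?C + card ((\<lambda>c. c \<otimes> y) ` ?C)"
    unfolding order_def S by (rule card_Un_le)
  also have "\<dots> \<le> card ?C + card ?C" using finC by (simp add: card_image_le)
  finally show ordx: "ord x = N" using le order cardC by simp
  show "y \<notin> ?C"
  proof
    assume "y \<in> ?C"
    then have "?S = ?C" using Cm by auto
    then show False using S cardC ordx order N by (simp add: order_def)
  qed
  show "cyclic_index_two G x (y \<otimes> y)"
  proof
    show "t \<otimes> t = y \<otimes> y" if "t \<in> carrier G" "t \<notin> ?C" for t
    proof -
      have "t \<in> (\<lambda>c. c \<otimes> y) ` ?C" using that S by blast
      then obtain c where c: "c \<in> ?C" "t = c \<otimes> y" by blast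
      then show ?thesis using mult2[OF c(1) c(1)] CG y by simp
    qed
  qed (use fin x order ordx yy y4 in auto)
qed

lemma dihedral_cyclic_index_two:
  fixes G (structure)
  assumes "dihedral G n r s" "n > 0"
  shows "group.ord G r = n" and "s \<notin> generate G {r}" and "cyclic_index_two G r \<one>\<^bsub>G\<^esub>"
proof -
  interpret group G using assms by (simp add: dihedral_def)
  have r: "r \<in> carrier G" and s: "s \<in> carrier G" using assms by (auto simp: dihedral_def)
  have ss: "s \<otimes> s = \<one>" using assms s by (simp add: dihedral_def numeral_2_eq_2)
  have "r \<otimes> s = (s \<otimes> s) \<otimes> (r \<otimes> s)" using r s ss by simp
  also have "\<dots> = s \<otimes> (s \<otimes> r \<otimes> s)" using r s by (simp add: m_assoc)
  also have "s \<otimes> r \<otimes> s = inv r" using assms by (simp add: dihedral_def)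
  finally have rs: "r \<otimes> s = s \<otimes> inv r" .
  note pres = cyclic_index_two_presentation[OF r s, of n]
  show "ord r = n" "s \<notin> generate G {r}" "cyclic_index_two G r \<one>"
    using pres assms ss rs by (auto simp: dihedral_def generate.one)
qed

lemma dicyclic_cyclic_index_two:
  fixes G (structure)
  assumes "dicyclic G n x y" "n > 0"
  shows "group.ord G x = 2 * n" and "cyclic_index_two G x (x [^]\<^bsub>G\<^esub> n)"
    and "group.ord G (x [^]\<^bsub>G\<^esub> n) = 2"
proof -
  interpret group G using assms by (simp add: dicyclic_def)
  have x: "x \<in> carrier G" and y: "y \<in> carrier G" using assms by (auto simp: dicyclic_def)
  have yy: "y \<otimes> y = x [^] n" using assms y by (simp add: dicyclic_def numeral_2_eq_2)
  have x2n: "x [^] (2 * n) = \<one>" using assms by (simp add: dicyclic_def)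
  have y4: "x [^] n \<otimes> x [^] n = \<one>" using x2n x by (simp add: nat_pow_mult mult_2)
  have "x \<otimes> y = y \<otimes> (inv y \<otimes> x \<otimes> y)"
    using x y by (simp add: inv_solve_left' m_assoc flip: m_assoc)
  also have "inv y \<otimes> x \<otimes> y = inv x" using assms by (simp add: dicyclic_def)
  finally have xy: "x \<otimes> y = y \<otimes> inv x" .
  have xn: "x [^] n \<in> generate G {x}"
    using generate_pow[OF x] by (metis (mono_tags, lifting) UNIV_I int_pow_int mem_Collect_eq)
  note pres = cyclic_index_two_presentation[OF x y, of "2 * n"]
  show ordx: "ord x = 2 * n" and "cyclic_index_two G x (x [^] n)"
    using pres assms yy y4 xy xn x2n by (auto simp: dicyclic_def)
  show "ord (x [^] n) = 2" using ordx assms(2) x by (subst ord_pow) auto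
qed

text \<open>The generalized quaternion group is the dicyclic group with parameter \<open>2 ^ (n - 2)\<close>.\<close>

lemma generalized_quaternion_dicyclic:
  assumes "generalized_quaternion G n x y" "n \<ge> 2"
  shows "dicyclic G (2 ^ (n - 2)) x y"
proof -
  have "(2::nat) ^ n = 4 * 2 ^ (n - 2)" "(2::nat) ^ (n - 1) = 2 * 2 ^ (n - 2)"
    using assms(2) by (auto simp: le_iff_add)
  then show ?thesis using assms(1) by (simp add: generalized_quaternion_def dicyclic_def)
qed

lemma iso_integer_mod_group_generator:
  fixes G (structure)
  assumes "group G" "G \<cong> integer_mod_group n" "n > 0"
  obtains x where "x \<in> carrier G" "carrier G = generate G {x}" "group.ord G x = n"
    "finite (carrier G)"
proof -
  interpret group G by fact
  have card: "card (carrier G) = n"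
    using iso_same_card[OF assms(2)] assms(3) by (simp add: carrier_integer_mod_group)
  then have fin: "finite (carrier G)" using assms(3) by (intro card_ge_0_finite) simp
  interpret Z: group "integer_mod_group n" by simp
  have "k \<in> range (\<lambda>i::int. g [^]\<^bsub>integer_mod_group n\<^esub> i)"
    if "k \<in> carrier (integer_mod_group n)" "g = 1 mod int n" for k g
    using that assms(3)
    by (intro range_eqI[of _ _ k]) (simp add: int_pow_integer_mod_group carrier_integer_mod_group mod_mult_right_eq)
  moreover have g: "1 mod int n \<in> carrier (integer_mod_group n)"
    using assms(3) by (simp add: carrier_integer_mod_group)
  ultimately have "cyclic_group (integer_mod_group n)"
    unfolding Z.cyclic_group using Z.int_pow_closed by (intro bexI[OF _ g]) blast
  then have "cyclic_group G"
    using isomorphic_group_cyclicity[OF assms(2)] by simp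
  then obtain x where x: "x \<in> carrier G" "carrier G = range (\<lambda>i::int. x [^] i)"
    unfolding cyclic_group by blast
  then have "carrier G = generate G {x}" using generate_pow[OF x(1)] by auto
  moreover from this have "ord x = n" using generate_pow_card[OF x(1)] card by simp
  ultimately show thesis using that x fin by blast
qed

lemma (in group) iso_Z2_iff_card:
  assumes H: "subgroup H G"
  shows "iso_Z2 G H \<longleftrightarrow> card H = 2"
proof
  assume "iso_Z2 G H"
  then show "card H = 2"
    using iso_same_card unfolding iso_Z2_def by (fastforce simp: carrier_integer_mod_group)
next
  assume card: "card H = 2"
  have one: "\<one> \<in> H" using H by (rule subgroup.one_closed)
  then obtain g where g: "H = {\<one>, g}" "g \<noteq> \<one>"
    using card by (auto simp: card_2_iff doubleton_eq_iff)
  have gG: "g \<in> carrier G" using H g(1) subgroup.subset by blast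
  have "g \<otimes> g \<in> H" using subgroup.m_closed[OF H] g(1) by blast
  moreover have "g \<otimes> g \<noteq> g" using gG g(2) by (metis l_cancel_one')
  ultimately have gg: "g \<otimes> g = \<one>" using g(1) by blast
  have "(\<lambda>u. if u = \<one> then 0 else 1 :: int) \<in> iso (G\<lparr>carrier := H\<rparr>) (integer_mod_group 2)"
    unfolding iso_def hom_def bij_betw_def inj_on_def
    using g gG gg by (auto simp: carrier_integer_mod_group)
  then show "iso_Z2 G H" unfolding iso_Z2_def is_iso_def by blast
qed

section \<open>Degrees in the four families\<close>

lemma (in group) csg_degree_cyclic:
  assumes "finite (carrier G)" "x \<in> carrier G" "carrier G = generate G {x}"
    and H: "H \<in> cyclic_subgroups G"
  shows "csg_degree G H = card (prime_factors (ord x div card H)) + card (prime_factors (card H))"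
    and "card H dvd ord x"
proof -
  have sub: "K \<subseteq> generate G {x}" if "K \<in> cyclic_subgroups G" for K
    using cyclic_subgroups_subgroup[OF that] assms(3) by (metis subgroup.subset)
  then have "{K. csg_adj G H K} = {K. K \<subseteq> generate G {x} \<and> csg_adj G H K}"
    unfolding csg_adj_def by blast
  then show "csg_degree G H
      = card (prime_factors (ord x div card H)) + card (prime_factors (card H))"
    using card_neighbours_in_cyclic(2)[OF assms(1,2) cyclic_subgroups_subgroup[OF H] sub[OF H]]
    by (simp add: csg_degree_def)
  show "card H dvd ord x"
    using subgroup_of_cyclic(1)[OF assms(1,2) cyclic_subgroups_subgroup[OF H] sub[OF H]] .
qed

lemma csg_degree_dicyclic:
  fixes G (structure)
  assumes dic: "dicyclic G n x y" and n: "n > 0" and H: "H \<in> cyclic_subgroups G"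
  shows "card H = 2 \<Longrightarrow> csg_degree G H = card (prime_factors n) + n + 1"
    and "H \<subseteq> generate G {x} \<Longrightarrow> card H \<noteq> 2 \<Longrightarrow>
      csg_degree G H = card (prime_factors (2 * n div card H)) + card (prime_factors (card H))"
    and "H \<subseteq> generate G {x} \<Longrightarrow> card H dvd 2 * n"
    and "\<not> H \<subseteq> generate G {x} \<Longrightarrow> card H = 4 \<and> csg_degree G H = 1"
proof -
  note D = dicyclic_cyclic_index_two[OF dic n]
  interpret D: cyclic_index_two G x "x [^] n" by (rule D(2))
  note Hs = D.cyclic_subgroups_subgroup[OF H]
  let ?Z = "generate G {x [^] n}"
  have cardZ: "card ?Z = 2" using D.generate_pow_card[OF D.z_carrier] D(3) by simp
  have Zs: "subgroup ?Z G" using D.generate_z_cyclic(1) by (rule D.cyclic_subgroups_subgroup)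
  show outer: "card H = 4 \<and> csg_degree G H = 1" if "\<not> H \<subseteq> generate G {x}"
    using D.card_outer_cyclic_subgroup[OF H that] D.csg_degree_outer[OF H that] D(3) by simp
  show "csg_degree G H = card (prime_factors n) + n + 1" if card: "card H = 2"
  proof -
    have sub: "H \<subseteq> generate G {x}" using outer card by auto
    have "H = ?Z"
      using D.subgroup_of_cyclic_eqI[OF D.fin D.x Hs sub Zs D.generate_z_cyclic(2)] card cardZ
      by simp
    moreover have "card (prime_factors (2::nat)) = 1"
      using card_prime_factors_power_two[of 1] by simp
    ultimately show ?thesis
      using D.csg_degree_inner[OF H sub] card D(1,3) by simp
  qed
  show "csg_degree G H = card (prime_factors (2 * n div card H)) + card (prime_factors (card H))"
    if "H \<subseteq> generate G {x}" "card H \<noteq> 2"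
    using D.csg_degree_inner[OF H that(1)] that(2) cardZ D(1) by auto
  show "card H dvd 2 * n" if "H \<subseteq> generate G {x}"
    using D.subgroup_of_cyclic(1)[OF D.fin D.x Hs that] D(1) by simp
qed

lemma csg_degree_generalized_quaternion:
  fixes G (structure)
  assumes Q: "generalized_quaternion G n x y" and n: "n \<ge> 3"
    and M: "M \<in> cyclic_subgroups G" "card M = 2 ^ (n - 1)" and H: "H \<in> cyclic_subgroups G"
  shows "card H = 2 \<Longrightarrow> csg_degree G H = 2 ^ (n - 2) + 2"
    and "{\<one>} \<subset> H \<Longrightarrow> H \<subset> M \<Longrightarrow> card H \<noteq> 2 \<Longrightarrow> csg_degree G H = 2"
    and "card H \<noteq> 2 \<Longrightarrow> \<not> ({\<one>} \<subset> H \<and> H \<subset> M) \<Longrightarrow> csg_degree G H = 1"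
proof -
  have dic: "dicyclic G (2 ^ (n - 2)) x y"
    using generalized_quaternion_dicyclic[OF Q] n by simp
  interpret group G using Q by (simp add: generalized_quaternion_def)
  let ?C = "generate G {x}"
  have pos: "(2::nat) ^ (n - 2) > 0" by simp
  have N: "2 * 2 ^ (n - 2) = (2::nat) ^ (n - 1)" using n by (auto simp: le_iff_add)
  note degH = csg_degree_dicyclic[OF dic pos H] and degM = csg_degree_dicyclic[OF dic pos M(1)]
  note Hs = cyclic_subgroups_subgroup[OF H] and Ms = cyclic_subgroups_subgroup[OF M(1)]
  have x: "x \<in> carrier G" using Q by (simp add: generalized_quaternion_def)
  have cardC: "card ?C = 2 ^ (n - 1)"
    using dicyclic_cyclic_index_two(1)[OF dic pos] generate_pow_card[OF x] N by simp
  have "finite ?C" "finite M" by (rule card_ge_0_finite, simp add: cardC M(2))+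
  have MC: "M = ?C" if "M \<subseteq> ?C"
    using card_subset_eq[OF \<open>finite ?C\<close> that] M(2) cardC by simp
  \<comment> \<open>Elements outside \<open>\<langle>x\<rangle>\<close> have order 4, so \<open>M\<close> can differ from \<open>\<langle>x\<rangle>\<close> only in the group of
    order 8.\<close>
  have Mn: "n = 3" if "\<not> M \<subseteq> ?C"
  proof -
    have "(2::nat) ^ (n - 1) = 2 ^ 2" using degM(4)[OF that] M(2) by simp
    then have "n - 1 = 2" by (rule power_inject_exp[THEN iffD1, rotated]) simp
    then show ?thesis by simp
  qed
  have one: "\<one> \<in> H" using Hs by (rule subgroup.one_closed)
  have trivial: "card H = 1 \<longleftrightarrow> H = {\<one>}"
    using one by (auto simp: card_1_singleton_iff)
  \<comment> \<open>The order of a subgroup of \<open>\<langle>x\<rangle>\<close> is a power of two, so each of the two counts of primes is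
    0 or 1.\<close>
  have inner: "\<exists>j \<le> n - 1. card H = 2 ^ j \<and>
      csg_degree G H = (if j = n - 1 then 0 else 1) + (if j = 0 then 0 else 1)"
    if sub: "H \<subseteq> ?C" and c2: "card H \<noteq> 2"
  proof -
    have "card H dvd 2 ^ (n - 1)" using degH(3)[OF sub] N by simp
    then obtain j where j: "j \<le> n - 1" "card H = 2 ^ j"
      by (auto simp: divides_primepow_nat)
    then have "2 ^ (n - 1) div card H = 2 ^ (n - 1 - j)"
      by (subst power_diff) auto
    then show ?thesis
      using degH(2)[OF sub c2] j N by (auto simp: card_prime_factors_power_two)
  qed
  show "csg_degree G H = 2 ^ (n - 2) + 2" if "card H = 2"
    using degH(1)[OF that] n by (simp add: card_prime_factors_power_two)
  show "csg_degree G H = 2" if HM: "{\<one>} \<subset> H" "H \<subset> M" and c2: "card H \<noteq> 2"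
  proof -
    have lt: "card H < card M" using \<open>finite M\<close> HM(2) by (rule psubset_card_mono)
    have "H \<subseteq> ?C" and "card H \<noteq> 2 ^ (n - 1)"
      using degH(4) degM(4) lt M(2) MC HM(2) card_dvd_card_subgroup[OF Hs Ms] Mn by fastforce+
    moreover have "card H \<noteq> 1" using trivial HM(1) by blast
    ultimately show ?thesis using inner c2 by (metis one_add_one power_0)
  qed
  show "csg_degree G H = 1" if c2: "card H \<noteq> 2" and nHM: "\<not> ({\<one>} \<subset> H \<and> H \<subset> M)"
  proof (cases "H \<subseteq> ?C")
    case True
    obtain j where j: "j \<le> n - 1" "card H = 2 ^ j"
      "csg_degree G H = (if j = n - 1 then 0 else 1) + (if j = 0 then 0 else 1)"
      using inner[OF True c2] by blast
    have "j = 0 \<or> j = n - 1"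
    proof (cases "M \<subseteq> ?C")
      case MsubC: True
      then have "H = {\<one>} \<or> H = M" using nHM one True MC by blast
      then have "(2::nat) ^ j = 2 ^ 0 \<or> (2::nat) ^ j = 2 ^ (n - 1)"
        using j(2) M(2) trivial by auto
      then show ?thesis by (simp only: power_inject_exp one_less_numeral_iff semiring_norm)
    next
      case False
      then have "n = 3" by (rule Mn)
      moreover have "j \<noteq> 1" using j(2) c2 by auto
      ultimately show ?thesis using j(1) by auto
    qed
    then show ?thesis using j(3) n by auto
  qed (use degH(4) in blast)
qed

theorem theorem2p7:
  fixes G :: "('a, 'm) monoid_scheme" and H :: "'a set"
    and n k :: nat and p a b :: "nat \<Rightarrow> nat"
  assumes "group G"
    and "\<And>i. i \<in> {1..k} \<Longrightarrow> prime (p i)"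
    and "inj_on p {1..k}"
    and "\<And>i. i \<in> {1..k} \<Longrightarrow> a i \<ge> 1"
    and "n = (\<Prod>i\<in>{1..k}. p i ^ a i)"
    and "H \<in> cyclic_subgroups G"
  shows
    "(G \<cong> integer_mod_group n \<longrightarrow>
        card H = (\<Prod>i\<in>{1..k}. p i ^ b i) \<longrightarrow>
        int (csg_degree G H) = 2 * int k - int (m_count k b) - int (r_count k a b))
   \<and> (\<forall>r s. dihedral G n r s \<longrightarrow>
        ((\<exists>i::nat. H = generate G {s \<otimes>\<^bsub>G\<^esub> r [^]\<^bsub>G\<^esub> i}) \<longrightarrow> csg_degree G H = 1)
      \<and> (H = {\<one>\<^bsub>G\<^esub>} \<longrightarrow> csg_degree G H = k + n)
      \<and> (H \<noteq> {\<one>\<^bsub>G\<^esub>} \<and> (\<exists>i::nat. H = generate G {r [^]\<^bsub>G\<^esub> i}) \<longrightarrow>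
           card H = (\<Prod>i\<in>{1..k}. p i ^ b i) \<longrightarrow>
           int (csg_degree G H) = 2 * int k - int (m_count k b) - int (r_count k a b)))
   \<and> (\<forall>x y M. n \<ge> 3 \<and> generalized_quaternion G n x y \<and>
          M \<in> cyclic_subgroups G \<and> card M = 2 ^ (n - 1) \<longrightarrow>
        (iso_Z2 G H \<longrightarrow> csg_degree G H = 2 ^ (n - 2) + 2)
      \<and> ({\<one>\<^bsub>G\<^esub>} \<subset> H \<and> H \<subset> M \<and> \<not> iso_Z2 G H \<longrightarrow> csg_degree G H = 2)
      \<and> (\<not> iso_Z2 G H \<and> \<not> ({\<one>\<^bsub>G\<^esub>} \<subset> H \<and> H \<subset> M) \<longrightarrow> csg_degree G H = 1))
   \<and> (\<forall>x y. dicyclic G n x y \<longrightarrow>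
        (iso_Z2 G H \<longrightarrow> csg_degree G H = k + n + 1)
      \<and> (H \<subseteq> generate G {x} \<and> even n \<and> card H \<noteq> 2 \<longrightarrow>
           card H = (\<Prod>i\<in>{1..k}. p i ^ b i) \<longrightarrow>
           int (csg_degree G H) = 2 * int k - int (m_count k b)
             - int (r_count k (\<lambda>i. if p i = 2 then a i + 1 else a i) b))
      \<and> (H \<subseteq> generate G {x} \<and> odd n \<and> card H \<noteq> 2 \<longrightarrow>
           card H = 2 ^ b (k + 1) * (\<Prod>i\<in>{1..k}. p i ^ b i) \<longrightarrow>
           int (csg_degree G H) = 2 * (int k + 1) - int (m_count (k + 1) b)
             - int (r_count (k + 1) (a(k + 1 := 1)) b))
      \<and> (\<not> iso_Z2 G H \<and> \<not> (H \<subseteq> generate G {x} \<and> card H \<noteq> 2) \<longrightarrow>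
           csg_degree G H = 1))"
proof -
  interpret group G by fact
  note pr = assms(2) and inj = assms(3) and a1 = assms(4) and n_eq = assms(5) and H = assms(6)
  have n0: "n > 0" unfolding n_eq using pr by (auto simp: prime_gt_0_nat)
  have pf_n: "card (prime_factors n) = k"
  proof -
    have "{i \<in> {1..k}. a i \<noteq> 0} = {1..k}" using a1 by force
    moreover have "prime_factors n = p ` {i \<in> {1..k}. a i \<noteq> 0}"
      unfolding n_eq using pr by (intro prime_factors_prod_prime_powers) auto
    ultimately show ?thesis using inj by (simp add: card_image)
  qed
  have Hs: "subgroup H G" using H by (rule cyclic_subgroups_subgroup)
  note Z2 = iso_Z2_iff_card[OF Hs]
  note exponents = card_prime_factors_exponents[of "{1..k}" p n a "card H" b, OF _ pr inj n_eq]
  have cyclic: "int (csg_degree G H) = 2 * int k - int (m_count k b) - int (r_count k a b)"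
    if iso: "G \<cong> integer_mod_group n" and cardH: "card H = (\<Prod>i\<in>{1..k}. p i ^ b i)"
  proof -
    obtain x where x: "x \<in> carrier G" "carrier G = generate G {x}" "ord x = n"
      "finite (carrier G)"
      using iso_integer_mod_group_generator[OF assms(1) iso n0] .
    note deg = csg_degree_cyclic[OF x(4,1,2) H]
    have "card H dvd n" using deg(2) x(3) by simp
    then show ?thesis
      using exponents[OF _ _ cardH] deg(1) x(3) by (simp add: m_count_def r_count_def)
  qed
  have dihedral: "((\<exists>i::nat. H = generate G {s \<otimes>\<^bsub>G\<^esub> r [^]\<^bsub>G\<^esub> i}) \<longrightarrow> csg_degree G H = 1)
      \<and> (H = {\<one>\<^bsub>G\<^esub>} \<longrightarrow> csg_degree G H = k + n)
      \<and> (H \<noteq> {\<one>\<^bsub>G\<^esub>} \<and> (\<exists>i::nat. H = generate G {r [^]\<^bsub>G\<^esub> i}) \<longrightarrow>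
           card H = (\<Prod>i\<in>{1..k}. p i ^ b i) \<longrightarrow>
           int (csg_degree G H) = 2 * int k - int (m_count k b) - int (r_count k a b))"
    if dih: "dihedral G n r s" for r s
  proof -
    note D = dihedral_cyclic_index_two[OF dih n0]
    interpret D: cyclic_index_two G r "\<one>\<^bsub>G\<^esub>" by (rule D(3))
    have s: "s \<in> carrier G" using dih by (simp add: dihedral_def)
    have "csg_degree G H = 1" if refl: "H = generate G {s \<otimes>\<^bsub>G\<^esub> r [^]\<^bsub>G\<^esub> i}" for i :: nat
    proof -
      let ?u = "r [^]\<^bsub>G\<^esub> i"
      have u: "?u \<in> generate G {r}" "?u \<in> carrier G"
        using generate_pow_on_finite_carrier[OF D.fin D.x] D.x by auto
      have "s \<otimes>\<^bsub>G\<^esub> ?u \<notin> generate G {r}"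
      proof
        assume "s \<otimes>\<^bsub>G\<^esub> ?u \<in> generate G {r}"
        then have "s \<otimes>\<^bsub>G\<^esub> ?u \<otimes>\<^bsub>G\<^esub> inv\<^bsub>G\<^esub> ?u \<in> generate G {r}"
          using subgroup.m_inv_closed[OF D.C_subgroup u(1)] by (rule generate.eng)
        then show False using D(2) s u(2) by (simp add: m_assoc)
      qed
      then have "\<not> H \<subseteq> generate G {r}"
        using refl generate.incl[of "s \<otimes>\<^bsub>G\<^esub> ?u" "{s \<otimes>\<^bsub>G\<^esub> ?u}" G] by blast
      then show ?thesis by (rule D.csg_degree_outer[OF H])
    qed
    moreover have "csg_degree G H = k + n" if "H = {\<one>\<^bsub>G\<^esub>}"
      using D.csg_degree_inner[OF H] that D(1) pf_n D.generate_z_cyclic(2)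
      by (simp add: generate_one)
    moreover have "int (csg_degree G H) = 2 * int k - int (m_count k b) - int (r_count k a b)"
      if nt: "H \<noteq> {\<one>\<^bsub>G\<^esub>}" and rot: "H = generate G {r [^]\<^bsub>G\<^esub> i}"
        and cardH: "card H = (\<Prod>i\<in>{1..k}. p i ^ b i)" for i :: nat
    proof -
      have sub: "H \<subseteq> generate G {r}" using rot generate_pow_subset[OF D.fin D.x] by simp
      have "card H dvd n" using subgroup_of_cyclic(1)[OF D.fin D.x Hs sub] D(1) by simp
      then show ?thesis
        using exponents[OF _ _ cardH] D.csg_degree_inner[OF H sub] nt D(1)
        by (simp add: m_count_def r_count_def generate_one)
    qed
    ultimately show ?thesis by blast
  qed
  have quaternion: "(iso_Z2 G H \<longrightarrow> csg_degree G H = 2 ^ (n - 2) + 2)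
      \<and> ({\<one>\<^bsub>G\<^esub>} \<subset> H \<and> H \<subset> M \<and> \<not> iso_Z2 G H \<longrightarrow> csg_degree G H = 2)
      \<and> (\<not> iso_Z2 G H \<and> \<not> ({\<one>\<^bsub>G\<^esub>} \<subset> H \<and> H \<subset> M) \<longrightarrow> csg_degree G H = 1)"
    if "n \<ge> 3" "generalized_quaternion G n x y" "M \<in> cyclic_subgroups G" "card M = 2 ^ (n - 1)"
    for x y M
    unfolding Z2 using csg_degree_generalized_quaternion[OF that(2,1,3,4) H] by blast
  \<comment> \<open>For even \<open>n\<close> the factorization of \<open>2 n\<close> arises from that of \<open>n\<close> by raising the exponent of the
    prime 2.\<close>
  have dicyclic_even: "int (card (prime_factors (2 * n div card H)) + card (prime_factors (card H)))
      = 2 * int k - int (m_count k b) - int (r_count k (\<lambda>i. if p i = 2 then a i + 1 else a i) b)"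
    if "even n" and dvd: "card H dvd 2 * n" and cardH: "card H = (\<Prod>i\<in>{1..k}. p i ^ b i)"
  proof -
    have "2 \<in> prime_factors n" using \<open>even n\<close> n0 by (simp add: in_prime_factors_iff)
    then obtain j where j: "j \<in> {1..k}" "p j = 2"
      using prime_factors_prod_prime_powers[of "{1..k}" p a] pr unfolding n_eq by auto
    have "(\<Prod>i\<in>{1..k}. p i ^ (if p i = 2 then a i + 1 else a i))
        = (\<Prod>i\<in>{1..k}. p i ^ a i * (if i = j then 2 else 1))"
      using j inj_on_eq_iff[OF inj _ j(1)] by (intro prod.cong refl) auto
    also have "\<dots> = 2 * n" using j(1) by (simp add: n_eq prod.distrib prod.delta)
    finally have "2 * n = (\<Prod>i\<in>{1..k}. p i ^ (if p i = 2 then a i + 1 else a i))" ..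
    from card_prime_factors_exponents[OF _ pr inj this cardH dvd]
    show ?thesis by (simp add: m_count_def r_count_def)
  qed
  \<comment> \<open>For odd \<open>n\<close> the prime 2 is new in \<open>2 n\<close>; it takes the index \<open>k + 1\<close>, where \<open>p\<close> has no prescribed
    value and is redefined.\<close>
  have dicyclic_odd: "int (card (prime_factors (2 * n div card H)) + card (prime_factors (card H)))
      = 2 * (int k + 1) - int (m_count (k + 1) b) - int (r_count (k + 1) (a(k + 1 := 1)) b)"
    if "odd n" and dvd: "card H dvd 2 * n"
      and cardH: "card H = 2 ^ b (k + 1) * (\<Prod>i\<in>{1..k}. p i ^ b i)"
  proof -
    let ?p = "p(k + 1 := 2)"
    have ins: "{1..k + 1} = insert (k + 1) {1..k}" by auto
    have ne: "p i \<noteq> 2" if "i \<in> {1..k}" for i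
    proof
      assume "p i = 2"
      moreover have "p i ^ a i dvd n" unfolding n_eq using that by (intro dvd_prodI) auto
      ultimately show False using a1[OF that] \<open>odd n\<close> by (auto dest: dvd_trans[rotated])
    qed
    have prod: "(\<Prod>i\<in>{1..k + 1}. ?p i ^ e i) = 2 ^ e (k + 1) * (\<Prod>i\<in>{1..k}. p i ^ e i)"
      for e :: "nat \<Rightarrow> nat"
    proof -
      have "(\<Prod>i\<in>{1..k}. ?p i ^ e i) = (\<Prod>i\<in>{1..k}. p i ^ e i)"
        by (rule prod.cong) auto
      then show ?thesis unfolding ins by simp
    qed
    have "(\<Prod>i\<in>{1..k}. p i ^ (a(k + 1 := 1)) i) = n"
      unfolding n_eq by (rule prod.cong) auto
    then have "2 * n = (\<Prod>i\<in>{1..k + 1}. ?p i ^ (a(k + 1 := 1)) i)"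
      unfolding prod by simp
    moreover have "card H = (\<Prod>i\<in>{1..k + 1}. ?p i ^ b i)" unfolding prod using cardH .
    moreover have "prime (?p i)" if "i \<in> {1..k + 1}" for i
      using that pr by auto
    moreover have "inj_on ?p {1..k + 1}"
    proof -
      have "inj_on ?p {1..k}" using inj ne by (intro inj_on_fun_updI) auto
      moreover have "2 \<notin> ?p ` {1..k}" using ne by fastforce
      ultimately show ?thesis unfolding ins by simp
    qed
    ultimately show ?thesis
      using card_prime_factors_exponents[of "{1..k + 1}" ?p "2 * n" "a(k + 1 := 1)" "card H" b] dvd
      by (simp add: m_count_def r_count_def)
  qed
  have dicyclic: "(iso_Z2 G H \<longrightarrow> csg_degree G H = k + n + 1)
      \<and> (H \<subseteq> generate G {x} \<and> even n \<and> card H \<noteq> 2 \<longrightarrow>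
           card H = (\<Prod>i\<in>{1..k}. p i ^ b i) \<longrightarrow>
           int (csg_degree G H) = 2 * int k - int (m_count k b)
             - int (r_count k (\<lambda>i. if p i = 2 then a i + 1 else a i) b))
      \<and> (H \<subseteq> generate G {x} \<and> odd n \<and> card H \<noteq> 2 \<longrightarrow>
           card H = 2 ^ b (k + 1) * (\<Prod>i\<in>{1..k}. p i ^ b i) \<longrightarrow>
           int (csg_degree G H) = 2 * (int k + 1) - int (m_count (k + 1) b)
             - int (r_count (k + 1) (a(k + 1 := 1)) b))
      \<and> (\<not> iso_Z2 G H \<and> \<not> (H \<subseteq> generate G {x} \<and> card H \<noteq> 2) \<longrightarrow> csg_degree G H = 1)"
    if "dicyclic G n x y" for x y
  proof -
    note deg = csg_degree_dicyclic[OF that n0 H]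
    show ?thesis
      unfolding Z2
    proof (intro conjI impI; (elim conjE)?)
      show "csg_degree G H = k + n + 1" if "card H = 2"
        using deg(1)[OF that] pf_n by simp
    next
      assume sub: "H \<subseteq> generate G {x}" and "card H \<noteq> 2"
      note deg' = deg(2)[OF this]
      show "int (csg_degree G H) = 2 * int k - int (m_count k b)
             - int (r_count k (\<lambda>i. if p i = 2 then a i + 1 else a i) b)"
        if "even n" "card H = (\<Prod>i\<in>{1..k}. p i ^ b i)"
        unfolding deg' using that(1) deg(3)[OF sub] that(2) by (rule dicyclic_even)
      show "int (csg_degree G H) = 2 * (int k + 1) - int (m_count (k + 1) b)
             - int (r_count (k + 1) (a(k + 1 := 1)) b)"
        if "odd n" "card H = 2 ^ b (k + 1) * (\<Prod>i\<in>{1..k}. p i ^ b i)"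
        unfolding deg' using that(1) deg(3)[OF sub] that(2) by (rule dicyclic_odd)
    next
      assume "card H \<noteq> 2" "\<not> (H \<subseteq> generate G {x} \<and> card H \<noteq> 2)"
      then show "csg_degree G H = 1" using deg(4) by blast
    qed
  qed
  show ?thesis
    by (rule conjI, intro impI, erule (1) cyclic,
        rule conjI, intro allI, rule impI, erule dihedral,
        rule conjI, intro allI, rule impI, elim conjE, erule (3) quaternion,
        intro allI, rule impI, erule dicyclic)
qed

end
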